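(* Consider the RBCD method with exact data for solving $\sum_{i=1}^bv_{li}Kx_i=y_l$, $l=1,\dots,d$. Assume that the matrix $V=(v_{li})$ has full column rank, and let $v^*:=\max\{\|v_i\|^2:i=1,\dots,b\}$, where $v_i$ is the $i$-th column of $V$. If $0<\gamma<2/(v^*\|K\|^2)$, then $\|x_k-x^\dagger\|\to0$ almost surely and $\mathbb E[\|x_k-x^\dagger\|^2]\to0$ as $k\to\infty$, where $x^\dagger$ denotes the unique $x_0$-minimum-norm solution of the system.
   Context: Let $X,Y$ be real Hilbert spaces, $K:X\to Y$ a bounded linear operator, and $V=(v_{li})$ a real $d\times b$ matrix. Define $A:X^b\to Y^d$ by $Ax:=\big(\sum_{i=1}^bv_{li}Kx_i\big)_{l=1}^d$ and $A_i:X\to Y^d$ by $A_iz:=(v_{li}Kz)_{l=1}^d$, so that $Ax=\sum_{i=1}^bA_ix_i$ and $A_i^*\tilde y=\sum_{l=1}^dv_{li}K^*\tilde y_l$; $X^b$ and $Y^d$ carry the product inner products. The system reads $Ax=y$ with $y=(y_1,\dots,y_d)\in Y^d$, and it is assumed that $y\in\mathrm{Ran}(A)$. RBCD method with exact data: let $i_0,i_1,\dots$ be independent random indices, each uniformly distributed on $\{1,\dots,b\}$. Starting from $x_0\in X^b$, with step size $\gamma>0$, for $k\ge0$ set $x_{k+1,i}=x_{k,i}$ for $i\ne i_k$ and $x_{k+1,i_k}=x_{k,i_k}-\gamma A_{i_k}^*(Ax_k-y)$. The $x_0$-minimum-norm solution is the solution $x$ of $Ax=y$ minimizing $\|x-x_0\|$.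 $\mathbb E$ denotes expectation with respect to the random indices; $\|v_i\|$ is the Euclidean norm. *)

theory Defs
  imports "HOL-Probability.Probability"
begin

text \<open>
  A real \<open>d \<times> b\<close> matrix is an element of \<open>real ^ 'b ^ 'd\<close> (so \<open>V $ l $ i\<close> is
  the entry in row \<open>l\<close> and column \<open>i\<close>). The spaces \<open>X\<^sup>b\<close> and \<open>Y\<^sup>d\<close> are \<open>'x ^ 'b\<close> and
  \<open>'y ^ 'd\<close> with the library's product inner product and norm.
\<close>

definition system_op ::
  "real ^ 'b ^ 'd \<Rightarrow> ('x :: real_inner \<Rightarrow>\<^sub>L 'y :: real_inner) \<Rightarrow> 'x ^ 'b \<Rightarrow> 'y ^ 'd"
  where "system_op V K x = (\<chi> l. \<Sum>i\<in>UNIV. (V $ l $ i) *\<^sub>R blinfun_apply K (x $ i))"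

definition block_op ::
  "real ^ 'b ^ 'd \<Rightarrow> ('x :: real_inner \<Rightarrow>\<^sub>L 'y :: real_inner) \<Rightarrow> 'b \<Rightarrow> 'x \<Rightarrow> 'y ^ 'd"
  where "block_op V K i z = (\<chi> l. (V $ l $ i) *\<^sub>R blinfun_apply K z)"

text \<open>
  The argument \<open>i\<close> is one realisation of the index sequence. The library's
  \<^const>\<open>adjoint\<close> is a choice among maps satisfying the adjoint identity; one exists, and
  is unique, for a bounded operator on a Hilbert space.
\<close>

primrec rbcd ::
  "real ^ 'b ^ 'd \<Rightarrow> ('x :: real_inner \<Rightarrow>\<^sub>L 'y :: real_inner) \<Rightarrow> 'y ^ 'd \<Rightarrow> real \<Rightarrow> 'x ^ 'b \<Rightarrow>
    (nat \<Rightarrow> 'b) \<Rightarrow> nat \<Rightarrow> 'x ^ 'b"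
  where
    "rbcd V K y \<gamma> x0 i 0 = x0"
  | "rbcd V K y \<gamma> x0 i (Suc k) =
      (let x = rbcd V K y \<gamma> x0 i k in
        \<chi> j. if j = i k
             then x $ j - \<gamma> *\<^sub>R adjoint (block_op V K (i k)) (system_op V K x - y)
             else x $ j)"

definition min_norm_solution ::
  "real ^ 'b ^ 'd \<Rightarrow> ('x :: real_inner \<Rightarrow>\<^sub>L 'y :: real_inner) \<Rightarrow> 'y ^ 'd \<Rightarrow> 'x ^ 'b \<Rightarrow> 'x ^ 'b \<Rightarrow> bool"
  where "min_norm_solution V K y x0 x \<longleftrightarrow>
    is_arg_min (\<lambda>x. norm (x - x0)) (\<lambda>x. system_op V K x = y) x"

definition vstar :: "real ^ 'b ^ 'd \<Rightarrow> real"
  where "vstar V = (MAX i. (norm (column i V))\<^sup>2)"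

end

theory Submission
  imports Defs
begin

text \<open>
  The errors \<open>e\<^sub>k = x\<^sub>k - x\<^sup>\<dagger>\<close> follow a homogeneous recursion driven by \<open>T = K\<^sup>* K\<close>. The plain norm of
  \<open>e\<^sub>k\<close> need not decrease, but \<open>energy V e = \<parallel>V e\<parallel>\<^sup>2\<close> does, for every index sequence: a step in block \<open>j\<close>
  lowers it by at least a constant times \<open>\<parallel>K (V\<^sup>T V e)\<^sub>j\<parallel>\<^sup>2\<close>. Full column rank makes the two norms
  equivalent. Since \<open>T\<close> acts blockwise it commutes with the iteration, so \<open>e\<^sub>0 = T u\<^sub>0\<close> gives
  \<open>e\<^sub>k = T u\<^sub>k\<close> with \<open>u\<^sub>k\<close> bounded, and then \<open>(energy V e\<^sub>k)\<^sup>2\<close> is at most a constant times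
  \<open>\<Sum>\<^sub>j \<parallel>K (V\<^sup>T V e\<^sub>k)\<^sub>j\<parallel>\<^sup>2\<close>, whose expectations are summable in \<open>k\<close>. General \<open>e\<^sub>0\<close> are limits of such
  starting points, because the blockwise range of \<open>T\<close> is dense in the orthogonal complement of the
  kernel of the system. Expected energy therefore tends to zero, and monotonicity upgrades this to
  almost sure convergence.
\<close>

section \<open>Hilbert space background: orthogonal projection, Riesz representation,
  adjoints\<close>

lemma hilbert_projection:
  fixes C :: "'a :: {real_inner, complete_space} set"
  assumes "closed C" and sub: "subspace C"
  obtains p where "p \<in> C" "\<And>c. c \<in> C \<Longrightarrow> (z - p) \<bullet> c = 0"
proof -
  define d where "d = (INF c\<in>C. (norm (z - c))\<^sup>2)"
  have bdd: "bdd_below ((\<lambda>c. (norm (z - c))\<^sup>2) ` C)"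
    by (rule bdd_belowI[of _ 0]) auto
  have ne: "C \<noteq> {}" using sub subspace_0 by blast
  have d_le: "d \<le> (norm (z - c))\<^sup>2" if "c \<in> C" for c
    unfolding d_def using bdd that by (rule cINF_lower)
  have "\<exists>c\<in>C. (norm (z - c))\<^sup>2 < d + inverse (real (Suc n))" for n
    using cINF_less_iff[OF ne bdd, of "d + inverse (real (Suc n))"] unfolding d_def by simp
  then obtain s where s: "\<And>n. s n \<in> C"
    and s_lt: "\<And>n. (norm (z - s n))\<^sup>2 < d + inverse (real (Suc n))" by metis
  \<comment> \<open>Parallelogram law for \<open>z - s m\<close> and \<open>z - s n\<close>. The
    midpoint lies in \<open>C\<close>, so its squared distance to \<open>z\<close> is at least
    \<open>d\<close>; the resulting \<open>4 * d\<close> cancels the two terms \<open>2 * d\<close>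
    coming from near-minimality.\<close>
  have par: "(norm (s m - s n))\<^sup>2 \<le> 2 * inverse (real (Suc m)) + 2 * inverse (real (Suc n))" for m n
  proof -
    have "(1/2) *\<^sub>R (s m + s n) \<in> C"
      using sub s by (simp add: subspace_add subspace_scale)
    then have "d \<le> (norm (z - (1/2) *\<^sub>R (s m + s n)))\<^sup>2" by (rule d_le)
    moreover have "(norm (s m - s n))\<^sup>2 = 2 * (norm (z - s m))\<^sup>2 + 2 * (norm (z - s n))\<^sup>2
        - 4 * (norm (z - (1/2) *\<^sub>R (s m + s n)))\<^sup>2"
      by (simp add: power2_norm_eq_inner inner_simps inner_commute algebra_simps)
    ultimately show ?thesis using s_lt[of m] s_lt[of n] by linarith
  qed
  have "Cauchy s"
  proof (rule metric_CauchyI)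
    fix e :: real assume "0 < e"
    then obtain N where N: "inverse (real (Suc N)) < e\<^sup>2 / 4"
      using reals_Archimedean[of "e\<^sup>2 / 4"] by auto
    have "dist (s m) (s n) < e" if "m \<ge> N" "n \<ge> N" for m n
    proof -
      have "inverse (real (Suc m)) \<le> inverse (real (Suc N))" "inverse (real (Suc n)) \<le> inverse (real (Suc N))"
        using that by auto
      then have "(norm (s m - s n))\<^sup>2 < e\<^sup>2" using par[of m n] N by linarith
      then show ?thesis using \<open>0 < e\<close> by (simp add: dist_norm power2_less_imp_less)
    qed
    then show "\<exists>N. \<forall>m\<ge>N. \<forall>n\<ge>N. dist (s m) (s n) < e" by blast
  qed
  then obtain p where lim: "s \<longlonglongrightarrow> p"
    using Cauchy_convergent convergent_def by blast
  have p: "p \<in> C" using \<open>closed C\<close> s lim closed_sequentially by blast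
  have "(\<lambda>n. (norm (z - s n))\<^sup>2) \<longlonglongrightarrow> (norm (z - p))\<^sup>2"
    by (intro tendsto_intros lim)
  moreover have "(\<lambda>n. d + inverse (real (Suc n))) \<longlonglongrightarrow> d + 0"
    by (intro tendsto_intros LIMSEQ_inverse_real_of_nat)
  ultimately have "(norm (z - p))\<^sup>2 \<le> d + 0"
    using s_lt by (intro LIMSEQ_le) (auto intro: less_imp_le)
  then have min: "(norm (z - p))\<^sup>2 \<le> (norm (z - c))\<^sup>2" if "c \<in> C" for c
    using d_le[OF that] by (metis add_0_right order_trans)
  have "(z - p) \<bullet> c = 0" if c: "c \<in> C" for c
  proof (cases "c = 0")
    case False
    have expand: "(norm (a - t *\<^sub>R c))\<^sup>2 = (norm a)\<^sup>2 - 2 * t * (a \<bullet> c) + t\<^sup>2 * (c \<bullet> c)" for a t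
      unfolding power2_norm_eq_inner
      by (simp add: inner_diff inner_commute power2_eq_square algebra_simps)
    \<comment> \<open>The minimiser of the quadratic \<open>expand\<close> along the line through
      \<open>p\<close> in direction \<open>c\<close>. Its value lies below the value at
      \<open>p\<close> by \<open>((z - p) \<bullet> c)\<^sup>2 / (c \<bullet> c)\<close>, which
      minimality of \<open>p\<close> forces to vanish.\<close>
    define t where "t = ((z - p) \<bullet> c) / (c \<bullet> c)"
    have "p + t *\<^sub>R c \<in> C" using sub p c by (simp add: subspace_add subspace_scale)
    then have "(norm (z - p))\<^sup>2 \<le> (norm ((z - p) - t *\<^sub>R c))\<^sup>2"
      using min[of "p + t *\<^sub>R c"] by (simp add: algebra_simps)
    also have "\<dots> = (norm (z - p))\<^sup>2 - 2 * t * ((z - p) \<bullet> c) + t\<^sup>2 * (c \<bullet> c)"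
      by (rule expand)
    also have "\<dots> = (norm (z - p))\<^sup>2 - ((z - p) \<bullet> c)\<^sup>2 / (c \<bullet> c)"
      using False by (simp add: t_def power2_eq_square field_simps)
    finally have "((z - p) \<bullet> c)\<^sup>2 / (c \<bullet> c) \<le> 0" by simp
    moreover have "c \<bullet> c > 0" using False by simp
    ultimately have "((z - p) \<bullet> c)\<^sup>2 \<le> 0" by (simp add: divide_le_0_iff)
    then show ?thesis by simp
  qed simp
  with p that show thesis by blast
qed

text \<open>A nonzero functional is determined by its closed kernel and one normal \<open>n\<close>
  to it. The normal is the part of some \<open>z\<close> with \<open>f z \<noteq> 0\<close> left
  over by projection onto the kernel, and it is rescaled so that the values at \<open>n\<close>
  agree.\<close>

lemma riesz_representation:
  fixes f :: "'a :: {real_inner, complete_space} \<Rightarrow> real"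
  assumes "bounded_linear f"
  obtains w where "\<And>x. f x = x \<bullet> w"
proof (cases "\<forall>x. f x = 0")
  case True
  then show thesis by (intro that[of 0]) simp
next
  case False
  interpret bounded_linear f by fact
  obtain z where z: "f z \<noteq> 0" using False by blast
  have "closed (f -` {0})"
    by (intro continuous_closed_vimage closed_singleton linear_continuous_at assms)
  moreover have "subspace (f -` {0})"
    by (auto simp: subspace_def add scaleR zero)
  ultimately obtain p where "p \<in> f -` {0}" and orth: "\<And>c. c \<in> f -` {0} \<Longrightarrow> (z - p) \<bullet> c = 0"
    using hilbert_projection by blast
  define n where "n = z - p"
  have fn: "f n \<noteq> 0" using z \<open>p \<in> _\<close> by (simp add: n_def diff)
  then have "n \<noteq> 0" using zero by auto
  have "f x = x \<bullet> ((f n / (n \<bullet> n)) *\<^sub>R n)" for x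
  proof -
    have "x - (f x / f n) *\<^sub>R n \<in> f -` {0}" using fn by (simp add: diff scaleR)
    then have "n \<bullet> (x - (f x / f n) *\<^sub>R n) = 0" unfolding n_def by (rule orth)
    then have "x \<bullet> n = (f x / f n) * (n \<bullet> n)" by (simp add: inner_simps inner_commute)
    then show ?thesis using fn \<open>n \<noteq> 0\<close> by (simp add: field_simps)
  qed
  then show thesis by (rule that)
qed

text \<open>Since \<open>adjoint\<close> is defined by choice, its identity becomes available only
  after some map satisfying it is exhibited. Riesz representation of
  \<open>\<lambda>x. K x \<bullet> y\<close> yields one value for each \<open>y\<close>, and
  \<open>adjoint_unique\<close> identifies the map so obtained.\<close>

lemma inner_adjoint_blinfun:
  fixes K :: "'x :: {real_inner, complete_space} \<Rightarrow>\<^sub>L 'y :: real_inner"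
  shows "K x \<bullet> y = x \<bullet> adjoint K y"
proof -
  have "\<exists>w. \<forall>x. K x \<bullet> y = x \<bullet> w" for y
  proof -
    have "bounded_linear (\<lambda>x. K x \<bullet> y)" by (intro bounded_linear_intros)
    then show ?thesis using riesz_representation by metis
  qed
  then obtain g where g: "\<forall>x y. K x \<bullet> y = x \<bullet> g y" by metis
  then have "adjoint K = g" by (rule adjoint_unique)
  with g show ?thesis by simp
qed

text \<open>Testing the adjoint identity at \<open>adjoint K y\<close> produces the square of the
  norm to be bounded, of which one factor cancels.\<close>

lemma norm_adjoint_blinfun:
  fixes K :: "'x :: {real_inner, complete_space} \<Rightarrow>\<^sub>L 'y :: real_inner"
  shows "norm (adjoint K y) \<le> norm K * norm y"
proof -
  have "(norm (adjoint K y))\<^sup>2 = K (adjoint K y) \<bullet> y"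
    by (simp add: power2_norm_eq_inner inner_adjoint_blinfun)
  also have "\<dots> \<le> norm (K (adjoint K y)) * norm y" by (rule norm_cauchy_schwarz)
  also have "\<dots> \<le> norm K * norm (adjoint K y) * norm y"
    by (intro mult_right_mono norm_blinfun) simp
  finally have "norm (adjoint K y) * norm (adjoint K y) \<le> (norm K * norm y) * norm (adjoint K y)"
    by (simp add: power2_eq_square mult_ac)
  then show ?thesis
    by (cases "norm (adjoint K y) = 0") (auto simp: mult_le_cancel_right)
qed

lemma bounded_linear_adjoint_blinfun:
  fixes K :: "'x :: {real_inner, complete_space} \<Rightarrow>\<^sub>L 'y :: real_inner"
  shows "bounded_linear (adjoint K)"
proof (rule bounded_linear_intro)
  fix a b :: 'y and r :: real
  have "x \<bullet> adjoint K (a + b) = x \<bullet> (adjoint K a + adjoint K b)" for x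
    by (simp add: inner_adjoint_blinfun[symmetric] inner_add_right)
  then show "adjoint K (a + b) = adjoint K a + adjoint K b" by (metis vector_eq_ldot)
  have "x \<bullet> adjoint K (r *\<^sub>R a) = x \<bullet> (r *\<^sub>R adjoint K a)" for x
    by (simp add: inner_adjoint_blinfun[symmetric])
  then show "adjoint K (r *\<^sub>R a) = r *\<^sub>R adjoint K a" by (metis vector_eq_ldot)
  show "norm (adjoint K a) \<le> norm a * norm K"
    using norm_adjoint_blinfun[of K a] by (simp add: mult.commute)
qed

section \<open>Matrices and operators acting on block vectors\<close>

text \<open>\<open>lift_mat A\<close> is the Kronecker product of \<open>A\<close> with the
  identity, and \<open>blockwise f\<close> that of the identity with \<open>f\<close>. Writing the
  system operator as a composition of the two separates matrix algebra from \<open>K\<close>; for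
  linear \<open>f\<close> the two kinds of factor commute.\<close>

definition lift_mat :: "real ^ 'n ^ 'm \<Rightarrow> 'a :: real_vector ^ 'n \<Rightarrow> 'a ^ 'm"
  where "lift_mat A x = (\<chi> l. \<Sum>i\<in>UNIV. (A $ l $ i) *\<^sub>R x $ i)"

definition blockwise :: "('a \<Rightarrow> 'b) \<Rightarrow> 'a ^ 'n \<Rightarrow> 'b ^ 'n"
  where "blockwise f x = (\<chi> i. f (x $ i))"

lemma bounded_linear_vec_lambda:
  fixes f :: "'n :: finite \<Rightarrow> 'a :: real_normed_vector \<Rightarrow> 'c :: real_normed_vector"
  assumes "\<And>i. bounded_linear (f i)"
  shows "bounded_linear (\<lambda>x. \<chi> i. f i x)"
proof -
  interpret f: bounded_linear "f i" for i by (rule assms)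
  obtain B where B: "\<And>i x. norm (f i x) \<le> norm x * B i"
    using f.bounded by metis
  show ?thesis
  proof (rule bounded_linear_intro)
    fix x
    have "norm (\<chi> i. f i x) \<le> (\<Sum>i\<in>UNIV. norm (f i x))"
      using norm_le_l1_cart by (simp add: norm_vec_def L2_set_le_sum)
    also have "\<dots> \<le> (\<Sum>i\<in>UNIV. norm x * B i)" by (intro sum_mono B)
    finally show "norm (\<chi> i. f i x) \<le> norm x * (\<Sum>i\<in>UNIV. B i)" by (simp add: sum_distrib_left)
  qed (simp_all add: vec_eq_iff f.add f.scaleR)
qed

lemma bounded_linear_lift_mat: "bounded_linear (lift_mat A)"
  for A :: "real ^ 'n ^ 'm"
  unfolding lift_mat_def
  by (intro bounded_linear_vec_lambda bounded_linear_sum bounded_linear_const_scaleR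
      bounded_linear_vec_nth)

lemma bounded_linear_blockwise:
  assumes "bounded_linear f"
  shows "bounded_linear (blockwise f)"
  unfolding blockwise_def
  by (intro bounded_linear_vec_lambda bounded_linear_compose[OF assms] bounded_linear_vec_nth)

lemma lift_mat_lift_mat: "lift_mat A (lift_mat B x) = lift_mat (A ** B) x"
proof -
  have "(\<Sum>i\<in>UNIV. A $ l $ i *\<^sub>R (\<Sum>j\<in>UNIV. B $ i $ j *\<^sub>R x $ j))
      = (\<Sum>j\<in>UNIV. (\<Sum>i\<in>UNIV. A $ l $ i * B $ i $ j) *\<^sub>R x $ j)" for l
    unfolding scaleR_sum_right scaleR_sum_left scaleR_scaleR by (rule sum.swap)
  then show ?thesis by (simp add: lift_mat_def matrix_matrix_mult_def vec_eq_iff)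
qed

lemma lift_mat_one: "lift_mat (mat 1) x = x"
proof -
  have "(if l = i then 1 else 0 :: real) *\<^sub>R x $ i = (if l = i then x $ i else 0)" for l i by simp
  then show ?thesis by (simp add: lift_mat_def mat_def vec_eq_iff)
qed

lemma inner_lift_mat: "lift_mat A x \<bullet> y = x \<bullet> lift_mat (transpose A) y"
  by (simp add: inner_vec_def lift_mat_def inner_sum_left inner_sum_right transpose_def)
    (rule sum.swap)

lemma lift_mat_blockwise:
  assumes "linear f"
  shows "lift_mat A (blockwise f x) = blockwise f (lift_mat A x)"
proof -
  interpret linear f by fact
  show ?thesis by (simp add: lift_mat_def blockwise_def vec_eq_iff sum scale)
qed

lemma lift_mat_axis: "lift_mat A (axis j z) = (\<chi> l. (A $ l $ j) *\<^sub>R z)"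
proof -
  have "A $ l $ i *\<^sub>R (axis j z $ i) = (if i = j then A $ l $ i *\<^sub>R z else 0)" for l i
    by (simp add: axis_def)
  then show ?thesis by (simp add: lift_mat_def vec_eq_iff)
qed

lemma power2_norm_vec: "(norm x)\<^sup>2 = (\<Sum>i\<in>UNIV. (norm (x $ i))\<^sup>2)"
  for x :: "'a :: real_normed_vector ^ 'n"
  by (simp add: norm_vec_def L2_set_def sum_nonneg)

text \<open>A vector supported in block \<open>j\<close> meets only column \<open>j\<close> of the
  matrix. This is how the column norms behind \<open>vstar\<close> enter the energy
  estimate.\<close>

lemma norm_lift_mat_axis:
  "norm (lift_mat A (axis j z)) = norm (column j A) * norm z"
  for z :: "'a :: real_normed_vector"
proof -
  have "(norm (lift_mat A (axis j z)))\<^sup>2 = (norm (column j A) * norm z)\<^sup>2"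
    by (simp add: power2_norm_vec lift_mat_axis column_def power_mult_distrib sum_distrib_right)
  then show ?thesis by simp
qed

lemma system_op_eq: "system_op V K x = lift_mat V (blockwise K x)"
  by (simp add: system_op_def lift_mat_def blockwise_def)

lemma bounded_linear_system_op: "bounded_linear (system_op V K)"
  unfolding system_op_eq[abs_def]
  by (rule bounded_linear_compose[OF bounded_linear_lift_mat
        bounded_linear_blockwise[OF blinfun.bounded_linear_right]])

text \<open>Moving the scalars \<open>V $ l $ i\<close> to the other side of the inner product
  gathers them into the transposed matrix. Applied to a residual \<open>V K e\<close>, the update
  direction thus becomes \<open>gram_op K\<close> of block \<open>i\<close> of
  \<open>V\<^sup>T V e\<close>.\<close>

lemma adjoint_block_op:
  fixes K :: "'x :: {real_inner, complete_space} \<Rightarrow>\<^sub>L 'y :: real_inner"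
  shows "adjoint (block_op V K i) w = adjoint K (lift_mat (transpose V) w $ i)"
proof -
  have "block_op V K i z \<bullet> w = z \<bullet> adjoint K (lift_mat (transpose V) w $ i)" for z w
  proof -
    have "block_op V K i z \<bullet> w = K z \<bullet> (lift_mat (transpose V) w $ i)"
      by (simp add: block_op_def inner_vec_def lift_mat_def transpose_def inner_sum_right)
    then show ?thesis by (simp add: inner_adjoint_blinfun)
  qed
  then show ?thesis by (intro fun_cong[OF adjoint_unique]) blast
qed

section \<open>The error recursion\<close>

abbreviation gram_op :: "('x :: real_inner \<Rightarrow>\<^sub>L 'y :: real_inner) \<Rightarrow> 'x \<Rightarrow> 'x"
  where "gram_op K \<equiv> \<lambda>z. adjoint K (K z)"

definition normal_block :: "real ^ 'b ^ 'd \<Rightarrow> 'a :: real_vector ^ 'b \<Rightarrow> 'a ^ 'b"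
  where "normal_block V e = lift_mat (transpose V) (lift_mat V e)"

text \<open>The recursion of the errors, with \<open>gram_op K\<close> replaced by a parameter
  \<open>T\<close>: the structural facts about it, linearity in the start and commutation with
  \<open>T\<close>, rest on linearity of \<open>T\<close> alone.\<close>

primrec block_path ::
  "real ^ 'b ^ 'd \<Rightarrow> ('x \<Rightarrow> 'x) \<Rightarrow> real \<Rightarrow> 'x :: real_vector ^ 'b \<Rightarrow> (nat \<Rightarrow> 'b) \<Rightarrow> nat \<Rightarrow> 'x ^ 'b"
  where
    "block_path V T \<gamma> e i 0 = e"
  | "block_path V T \<gamma> e i (Suc k) = block_path V T \<gamma> e i k
      - axis (i k) (\<gamma> *\<^sub>R T (normal_block V (block_path V T \<gamma> e i k) $ i k))"

lemma block_path_cong: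
  assumes "\<And>n. n < k \<Longrightarrow> i n = i' n"
  shows "block_path V T \<gamma> e i k = block_path V T \<gamma> e i' k"
  using assms by (induction k) auto

lemma bounded_linear_gram_op:
  fixes K :: "'x :: {real_inner, complete_space} \<Rightarrow>\<^sub>L 'y :: real_inner"
  shows "bounded_linear (gram_op K)"
  by (rule bounded_linear_compose[OF bounded_linear_adjoint_blinfun blinfun.bounded_linear_right])

lemma linear_lift_mat: "linear (lift_mat A)"
  by (rule linearI) (simp_all add: lift_mat_def vec_eq_iff scaleR_add_right sum.distrib
      scaleR_sum_right mult.commute)

lemma linear_normal_block: "linear (normal_block V)"
  unfolding normal_block_def
  using linear_compose[OF linear_lift_mat linear_lift_mat] by (simp add: comp_def)

lemma axis_diff: "axis j (a - b) = axis j a - axis j (b :: 'a :: ab_group_add)"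
  by (simp add: axis_def vec_eq_iff)

lemma block_path_diff:
  assumes "linear T"
  shows "block_path V T \<gamma> (e - e') i k = block_path V T \<gamma> e i k - block_path V T \<gamma> e' i k"
proof (induction k)
  case (Suc k)
  show ?case
    unfolding block_path.simps Suc
    by (simp add: linear_diff[OF linear_normal_block] linear_diff[OF assms] scaleR_diff_right
        axis_diff)
qed simp

text \<open>\<open>V\<^sup>T V\<close> mixes blocks by scalars only, so a linear \<open>T\<close>
  applied in every block passes through it; it also passes through the update of a single block
  because \<open>T 0 = 0\<close>. A source representation \<open>e = T u\<close> therefore persists
  along every index sequence, with sources that follow the same recursion.\<close>

lemma block_path_blockwise:
  assumes "linear T"
  shows "block_path V T \<gamma> (blockwise T u) i k = blockwise T (block_path V T \<gamma> u i k)"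
proof (induction k)
  case (Suc k)
  have step: "blockwise T a - axis j (\<gamma> *\<^sub>R T b) = blockwise T (a - axis j (\<gamma> *\<^sub>R b))" for a j b
    using linear_diff[OF assms] linear_scale[OF assms] linear_0[OF assms]
    by (simp add: blockwise_def axis_def vec_eq_iff)
  have "normal_block V (blockwise T a) $ j = T (normal_block V a $ j)" for a j
    by (simp add: normal_block_def lift_mat_blockwise[OF assms]) (simp add: blockwise_def)
  then show ?case by (simp add: Suc step)
qed simp

text \<open>Because the data are exact, the residual at \<open>x\<close> is the system operator
  applied to \<open>x - xd\<close>, for any solution \<open>xd\<close>. This makes the error
  recursion homogeneous.\<close>

lemma rbcd_error:
  fixes K :: "'x :: {real_inner, complete_space} \<Rightarrow>\<^sub>L 'y :: real_inner"
  assumes "system_op V K xd = y"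
  shows "rbcd V K y \<gamma> x0 i k - xd = block_path V (gram_op K) \<gamma> (x0 - xd) i k"
proof (induction k)
  case (Suc k)
  define x where "x = rbcd V K y \<gamma> x0 i k"
  have lin: "linear (blinfun_apply K)"
    by (rule bounded_linear.linear[OF blinfun.bounded_linear_right])
  have "system_op V K x - y = system_op V K (x - xd)"
    using linear_diff[OF bounded_linear.linear[OF bounded_linear_system_op]] assms by metis
  then have "adjoint (block_op V K (i k)) (system_op V K x - y)
      = gram_op K (normal_block V (x - xd) $ i k)"
    by (simp add: adjoint_block_op system_op_eq normal_block_def lift_mat_blockwise[OF lin])
      (simp add: blockwise_def)
  then have "rbcd V K y \<gamma> x0 i (Suc k) = x - axis (i k) (\<gamma> *\<^sub>R gram_op K (normal_block V (x - xd) $ i k))"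
    by (simp add: x_def[symmetric] Let_def axis_def vec_eq_iff)
  then show ?case using Suc by (simp add: x_def[symmetric])
qed simp

section \<open>The energy and its decay along every index sequence\<close>

text \<open>Half the gradient of this function is \<open>normal_block V e\<close>. A step in block
  \<open>j\<close> moves against block \<open>j\<close> of that gradient, preconditioned by the
  positive semidefinite \<open>gram_op K\<close>, which makes it a descent step when
  \<open>\<gamma>\<close> is small enough.\<close>

definition energy :: "real ^ 'b ^ 'd \<Rightarrow> 'a :: real_inner ^ 'b \<Rightarrow> real"
  where "energy V e = (norm (lift_mat V e))\<^sup>2"

lemma energy_nonneg: "0 \<le> energy V e"
  by (simp add: energy_def)

lemma norm_column_le_vstar: "(norm (column i V))\<^sup>2 \<le> vstar V"
  unfolding vstar_def by (rule Max_ge) auto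

text \<open>The coefficient left in the one-step estimate once the quadratic term has been absorbed:
  \<open>2 * \<gamma>\<close> from the cross term minus \<open>\<gamma>\<^sup>2\<close> times the
  bound on the squared operator norm.\<close>

definition step_gain :: "real ^ 'b ^ 'd \<Rightarrow> ('x :: real_inner \<Rightarrow>\<^sub>L 'y :: real_inner) \<Rightarrow> real \<Rightarrow> real"
  where "step_gain V K \<gamma> = \<gamma> * (2 - \<gamma> * (vstar V * (norm K)\<^sup>2))"

lemma step_gain_pos:
  assumes "0 < \<gamma>" "K \<noteq> 0 \<Longrightarrow> \<gamma> < 2 / (vstar V * (norm K)\<^sup>2)"
  shows "0 < step_gain V K \<gamma>"
proof -
  define L where "L = vstar V * (norm K)\<^sup>2"
  have "0 \<le> vstar V"
    using norm_column_le_vstar[of undefined V] by (rule order_trans[rotated]) simp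
  then have "0 \<le> L" by (simp add: L_def)
  have "\<gamma> * L < 2"
  \<comment> \<open>For \<open>L = 0\<close> the claim reads \<open>0 < 2\<close>; this includes
    \<open>K = 0\<close>, where no upper bound on \<open>\<gamma>\<close> is assumed. Otherwise
    \<open>K\<close> is nonzero and the bound can be multiplied out.\<close>
  proof (cases "L = 0")
    case False
    then have "K \<noteq> 0" by (auto simp: L_def)
    then have "\<gamma> < 2 / L" using assms by (simp add: L_def)
    with False \<open>0 \<le> L\<close> show ?thesis by (simp add: pos_less_divide_eq)
  qed simp
  then show ?thesis using assms(1) by (simp add: step_gain_def L_def)
qed

lemma energy_step:
  fixes K :: "'x :: {real_inner, complete_space} \<Rightarrow>\<^sub>L 'y :: real_inner"
  assumes "0 < \<gamma>"
  shows "energy V (e - axis j (\<gamma> *\<^sub>R gram_op K (normal_block V e $ j)))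
    \<le> energy V e - step_gain V K \<gamma> * (norm (K (normal_block V e $ j)))\<^sup>2"
proof -
  define g where "g = normal_block V e $ j"
  define W where "W = lift_mat V (axis j (\<gamma> *\<^sub>R gram_op K g))"
  \<comment> \<open>The cross term: moving \<open>V\<close> to the left factor leaves only block
    \<open>j\<close>, and moving \<open>adjoint K\<close> then turns the product into a
    square.\<close>
  have "lift_mat V e \<bullet> W = normal_block V e \<bullet> axis j (\<gamma> *\<^sub>R gram_op K g)"
    unfolding W_def normal_block_def by (metis inner_lift_mat inner_commute)
  also have "\<dots> = \<gamma> * (norm (K g))\<^sup>2"
    by (simp add: inner_axis g_def[symmetric] inner_adjoint_blinfun[symmetric] power2_norm_eq_inner)
  finally have cross: "lift_mat V e \<bullet> W = \<gamma> * (norm (K g))\<^sup>2" .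
  \<comment> \<open>The quadratic term: one factor comes from column \<open>j\<close> and one from
    the bound on \<open>adjoint K\<close>, so it is controlled by the same square as the cross
    term.\<close>
  have "(norm W)\<^sup>2 = (norm (column j V))\<^sup>2 * (\<gamma>\<^sup>2 * (norm (gram_op K g))\<^sup>2)"
    by (simp add: W_def norm_lift_mat_axis power_mult_distrib)
  also have "\<dots> \<le> vstar V * (\<gamma>\<^sup>2 * (norm K * norm (K g))\<^sup>2)"
    by (intro mult_mono norm_column_le_vstar mult_left_mono power_mono norm_adjoint_blinfun)
      (auto intro: order_trans[OF zero_le_power2 norm_column_le_vstar])
  finally have W: "(norm W)\<^sup>2 \<le> \<gamma>\<^sup>2 * (vstar V * (norm K)\<^sup>2) * (norm (K g))\<^sup>2"
    by (simp add: power_mult_distrib mult_ac)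
  have "energy V (e - axis j (\<gamma> *\<^sub>R gram_op K g)) = (norm (lift_mat V e - W))\<^sup>2"
    by (simp add: energy_def W_def linear_diff[OF linear_lift_mat])
  also have "\<dots> = energy V e - 2 * (lift_mat V e \<bullet> W) + (norm W)\<^sup>2"
    by (simp add: energy_def power2_norm_eq_inner inner_simps inner_commute)
  finally show ?thesis using W
    by (simp add: cross g_def step_gain_def power2_eq_square algebra_simps)
qed

text \<open>Telescoping of the one-step estimate. The bound does not depend on \<open>n\<close> or
  on the index sequence, and after taking expectations it yields summability in
  \<open>k\<close>.\<close>

lemma energy_path_gain:
  fixes K :: "'x :: {real_inner, complete_space} \<Rightarrow>\<^sub>L 'y :: real_inner" and e :: "'x ^ 'b"
  assumes "0 < \<gamma>"
  shows "energy V (block_path V (gram_op K) \<gamma> e i n) + step_gain V K \<gamma> *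
      (\<Sum>k<n. (norm (K (normal_block V (block_path V (gram_op K) \<gamma> e i k) $ i k)))\<^sup>2) \<le> energy V e"
proof (induction n)
  case (Suc n)
  then show ?case
    using energy_step[OF assms, of V "block_path V (gram_op K) \<gamma> e i n" "i n" K]
    by (simp add: algebra_simps)
qed simp

lemma energy_path_Suc_le:
  fixes K :: "'x :: {real_inner, complete_space} \<Rightarrow>\<^sub>L 'y :: real_inner" and e :: "'x ^ 'b"
  assumes "0 < \<gamma>" "0 < step_gain V K \<gamma>"
  shows "energy V (block_path V (gram_op K) \<gamma> e i (Suc n)) \<le> energy V (block_path V (gram_op K) \<gamma> e i n)"
proof -
  define e' where "e' = block_path V (gram_op K) \<gamma> e i n"
  have "0 \<le> step_gain V K \<gamma> * (norm (K (normal_block V e' $ i n)))\<^sup>2"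
    using assms(2) by simp
  then show ?thesis
    using energy_step[OF assms(1), of V e' "i n" K] by (simp add: e'_def)
qed

lemma energy_path_le:
  fixes K :: "'x :: {real_inner, complete_space} \<Rightarrow>\<^sub>L 'y :: real_inner" and e :: "'x ^ 'b"
  assumes "0 < \<gamma>" "0 < step_gain V K \<gamma>"
  shows "energy V (block_path V (gram_op K) \<gamma> e i n) \<le> energy V e"
proof (induction n)
  case (Suc n)
  then show ?case using energy_path_Suc_le[OF assms] order_trans by blast
qed simp

text \<open>Full column rank gives a left inverse of \<open>V\<close>. Lifted to block vectors it is
  a bounded map recovering \<open>e\<close> from \<open>lift_mat V e\<close>.\<close>

lemma norm_le_energy:
  fixes V :: "real ^ 'b ^ 'd"
  assumes "rank V = CARD('b)"
  obtains C where "0 \<le> C" "\<And>e :: 'a :: real_inner ^ 'b. (norm e)\<^sup>2 \<le> C * energy V e"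
proof -
  obtain L where L: "L ** V = mat 1"
    using assms full_rank_injective matrix_left_invertible_injective by blast
  obtain B where "\<And>x :: 'a ^ 'd. norm (lift_mat L x) \<le> norm x * B" and "0 \<le> B"
    using bounded_linear.nonneg_bounded[OF bounded_linear_lift_mat] by blast
  then have "norm e \<le> norm (lift_mat V e) * B" for e :: "'a ^ 'b"
    by (metis L lift_mat_lift_mat lift_mat_one)
  then have "(norm e)\<^sup>2 \<le> B\<^sup>2 * energy V e" for e :: "'a ^ 'b"
    using power_mono[of "norm e" "norm (lift_mat V e) * B" 2]
    by (simp add: energy_def power_mult_distrib mult.commute)
  then show thesis by (intro that[of "B\<^sup>2"]) auto
qed

lemma energy_diff_le: "energy V e \<le> 2 * energy V e' + 2 * energy V (e - e')"
proof -
  define a where "a = lift_mat V e'"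
  define b where "b = lift_mat V (e - e')"
  have "lift_mat V e = a + b" by (simp add: a_def b_def linear_diff[OF linear_lift_mat])
  then have "energy V e = (norm (a + b))\<^sup>2" by (simp add: energy_def)
  also have "\<dots> \<le> 2 * (norm a)\<^sup>2 + 2 * (norm b)\<^sup>2"
  proof -
    have "0 \<le> (a - b) \<bullet> (a - b)" by simp
    then show ?thesis by (simp add: power2_norm_eq_inner inner_simps inner_commute)
  qed
  finally show ?thesis by (simp add: a_def b_def energy_def)
qed

text \<open>The energy is the inner product of \<open>e\<close> with \<open>V\<^sup>T V e\<close>.
  If \<open>e\<close> has a source \<open>u\<close>, one factor \<open>K\<close> of
  \<open>gram_op K\<close> moves to the other side, and Cauchy-Schwarz separates the size of
  \<open>K u\<close> from the sum of squares. That sum adds up the gains available in all blocks,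
  hence what a uniformly chosen block realises on average up to constants.\<close>

lemma energy_source_bound:
  fixes K :: "'x :: {real_inner, complete_space} \<Rightarrow>\<^sub>L 'y :: real_inner" and u :: "'x ^ 'b"
  shows "(energy V (blockwise (gram_op K) u))\<^sup>2
    \<le> (norm (blockwise K u))\<^sup>2 * (\<Sum>j\<in>UNIV. (norm (K (normal_block V (blockwise (gram_op K) u) $ j)))\<^sup>2)"
proof -
  define e where "e = blockwise (gram_op K) u"
  have gram: "gram_op K a \<bullet> b = K a \<bullet> K b" for a b
    by (metis inner_adjoint_blinfun inner_commute)
  have "energy V e = e \<bullet> normal_block V e"
    by (simp add: energy_def power2_norm_eq_inner normal_block_def inner_lift_mat)
  also have "\<dots> = blockwise K u \<bullet> blockwise K (normal_block V e)"
    unfolding e_def inner_vec_def blockwise_def by (simp add: gram)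
  also have "\<dots> \<le> norm (blockwise K u) * norm (blockwise K (normal_block V e))"
    by (rule norm_cauchy_schwarz)
  finally have "(energy V e)\<^sup>2 \<le> (norm (blockwise K u) * norm (blockwise K (normal_block V e)))\<^sup>2"
    by (intro power_mono energy_nonneg)
  then show ?thesis
    by (simp add: e_def power_mult_distrib power2_norm_vec[of "blockwise K (normal_block V _)"])
      (simp add: blockwise_def)
qed

section \<open>The minimum-norm solution and the orthogonal complement of the kernel\<close>

lemma min_norm_solution_exists_unique:
  fixes K :: "'x :: {real_inner, complete_space} \<Rightarrow>\<^sub>L 'y :: real_inner" and x0 :: "'x ^ 'b"
  assumes "y \<in> range (system_op V K)"
  obtains xd where "system_op V K xd = y" "\<And>q. system_op V K q = 0 \<Longrightarrow> (x0 - xd) \<bullet> q = 0"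
    "\<And>x. min_norm_solution V K y x0 x \<longleftrightarrow> x = xd"
proof -
  interpret A: bounded_linear "system_op V K" by (rule bounded_linear_system_op)
  obtain xs where xs: "system_op V K xs = y" using assms by blast
  have "closed (system_op V K -` {0})"
    by (intro continuous_closed_vimage closed_singleton linear_continuous_at A.bounded_linear_axioms)
  moreover have "subspace (system_op V K -` {0})"
    by (auto simp: subspace_def A.add A.scaleR A.zero)
  ultimately obtain p where p: "p \<in> system_op V K -` {0}"
    and orth: "\<And>c. c \<in> system_op V K -` {0} \<Longrightarrow> ((x0 - xs) - p) \<bullet> c = 0"
    using hilbert_projection by blast
  \<comment> \<open>Adding to a particular solution the kernel component of \<open>x0 - xs\<close>
    leaves \<open>x0 - xd\<close> orthogonal to the kernel.\<close>
  define xd where "xd = xs + p"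
  have sol: "system_op V K xd = y" using p xs by (simp add: xd_def A.add)
  have perp: "(x0 - xd) \<bullet> q = 0" if "system_op V K q = 0" for q
    using orth[of q] that by (simp add: xd_def diff_diff_eq)
  \<comment> \<open>Two solutions differ by a kernel element, so Pythagoras applies. The excess over
    the distance of \<open>xd\<close> is \<open>(norm (x - xd))\<^sup>2\<close>, which gives both
    minimality and uniqueness.\<close>
  have pyth: "(norm (x - x0))\<^sup>2 = (norm (x - xd))\<^sup>2 + (norm (xd - x0))\<^sup>2" if "system_op V K x = y" for x
  proof -
    have "(x0 - xd) \<bullet> (x - xd) = 0" by (rule perp) (simp add: A.diff that sol)
    then have "orthogonal (x - xd) (xd - x0)"
      by (simp add: orthogonal_def inner_simps inner_commute)
    then show ?thesis using norm_add_Pythagorean[of "x - xd" "xd - x0"] by simp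
  qed
  have "min_norm_solution V K y x0 x \<longleftrightarrow> x = xd" for x
  proof
    assume "min_norm_solution V K y x0 x"
    then have x: "system_op V K x = y" and "\<not> norm (xd - x0) < norm (x - x0)"
      using sol by (auto simp: min_norm_solution_def is_arg_min_def)
    then have "(norm (x - x0))\<^sup>2 \<le> (norm (xd - x0))\<^sup>2" by (simp add: power_mono)
    with pyth[OF x] show "x = xd" by simp
  next
    assume "x = xd"
    have "norm (xd - x0) \<le> norm (z - x0)" if "system_op V K z = y" for z
      by (rule power2_le_imp_le) (simp_all add: pyth[OF that])
    with sol \<open>x = xd\<close> show "min_norm_solution V K y x0 x"
      by (force simp: min_norm_solution_def is_arg_min_def not_less)
  qed
  with sol perp show thesis by (rule that)
qed

lemma closure_subspace:
  fixes S :: "'a :: real_normed_vector set"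
  assumes "subspace S"
  shows "subspace (closure S)"
  unfolding subspace_def
proof (intro conjI ballI allI)
  show "0 \<in> closure S" using subspace_0[OF assms] closure_subset by blast
next
  fix x y assume "x \<in> closure S" "y \<in> closure S"
  then obtain a b where ab: "\<And>n. a n \<in> S" "\<And>n. b n \<in> S" and lim: "a \<longlonglongrightarrow> x" "b \<longlonglongrightarrow> y"
    unfolding closure_sequential by blast
  have "\<forall>n. a n + b n \<in> S" using ab subspace_add[OF assms] by blast
  with tendsto_add[OF lim] show "x + y \<in> closure S"
    unfolding closure_sequential by (intro exI[of _ "\<lambda>n. a n + b n"]) simp
next
  fix r :: real and x assume "x \<in> closure S"
  then obtain a where a: "\<And>n. a n \<in> S" and lim: "a \<longlonglongrightarrow> x"
    unfolding closure_sequential by blast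
  have "\<forall>n. r *\<^sub>R a n \<in> S" using a subspace_scale[OF assms] by blast
  with tendsto_scaleR[OF tendsto_const lim] show "r *\<^sub>R x \<in> closure S"
    unfolding closure_sequential by (intro exI[of _ "\<lambda>n. r *\<^sub>R a n"]) simp
qed

text \<open>Let \<open>q\<close> be the part of \<open>e\<close> orthogonal to the closed range.
  Being orthogonal to its own image, it satisfies \<open>K (q $ i) = 0\<close> in every block, hence
  lies in the kernel of the system. Then \<open>e\<close> is orthogonal to \<open>q\<close> by
  hypothesis and the projection is by construction, so \<open>q = 0\<close>.\<close>

lemma closure_range_blockwise_gram_op:
  fixes K :: "'x :: {real_inner, complete_space} \<Rightarrow>\<^sub>L 'y :: real_inner" and e :: "'x ^ 'b"
  assumes perp: "\<And>q. system_op V K q = 0 \<Longrightarrow> e \<bullet> q = 0"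
  shows "e \<in> closure (range (blockwise (gram_op K)))"
proof -
  let ?D = "blockwise (gram_op K) :: 'x ^ 'b \<Rightarrow> 'x ^ 'b"
  interpret D: bounded_linear ?D
    by (rule bounded_linear_blockwise[OF bounded_linear_gram_op])
  have "subspace (range ?D)"
    using D.linear subspace_UNIV by (rule linear_subspace_image)
  then have "subspace (closure (range ?D))" by (rule closure_subspace)
  from hilbert_projection[OF closed_closure this, of e]
  obtain p where p: "p \<in> closure (range ?D)"
    and orth: "\<And>c. c \<in> closure (range ?D) \<Longrightarrow> (e - p) \<bullet> c = 0"
    by metis
  define q where "q = e - p"
  have "?D q \<in> closure (range ?D)" by (rule subsetD[OF closure_subset rangeI])
  then have "q \<bullet> ?D q = 0" unfolding q_def by (rule orth)
  then have "(\<Sum>i\<in>UNIV. (norm (K (q $ i)))\<^sup>2) = 0"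
    by (simp add: inner_vec_def blockwise_def inner_adjoint_blinfun[symmetric] power2_norm_eq_inner)
  then have "\<forall>i. K (q $ i) = 0" by (subst (asm) sum_nonneg_eq_0_iff) auto
  then have "system_op V K q = 0" by (simp add: system_op_def vec_eq_iff)
  then have "e \<bullet> q = 0" by (rule perp)
  moreover have "q \<bullet> p = 0" using orth[OF p] by (simp add: q_def)
  ultimately have "q \<bullet> q = 0" by (simp add: q_def inner_simps inner_commute)
  then have "e = p" by (simp add: q_def)
  with p show ?thesis by simp
qed

section \<open>Expectations along independent uniform indices\<close>

text \<open>The iterate at time \<open>k\<close> reads the indices before \<open>k\<close> only.
  Since there are finitely many such prefixes, measurability and integrability of real functions of
  the iterate follow from this property alone, with no sigma-algebra on the space of
  iterates.\<close>

definition depends_on_prefix :: "nat \<Rightarrow> ((nat \<Rightarrow> 'b) \<Rightarrow> 'c) \<Rightarrow> bool"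
  where "depends_on_prefix k F \<longleftrightarrow> (\<forall>s s'. (\<forall>n<k. s n = s' n) \<longrightarrow> F s = F s')"

lemma depends_on_prefix_block_path: "depends_on_prefix k (\<lambda>s. F (block_path V T \<gamma> e s k))"
  for V :: "real ^ 'b ^ 'd"
  unfolding depends_on_prefix_def
proof (intro allI impI)
  fix s s' :: "nat \<Rightarrow> 'b" assume "\<forall>n<k. s n = s' n"
  then have "block_path V T \<gamma> e s k = block_path V T \<gamma> e s' k" by (intro block_path_cong) blast
  then show "F (block_path V T \<gamma> e s k) = F (block_path V T \<gamma> e s' k)" by simp
qed

context prob_space
begin

context
  fixes I :: "nat \<Rightarrow> 'a \<Rightarrow> 'b :: finite"
  assumes indep: "indep_vars (\<lambda>_. count_space UNIV) I UNIV"
begin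

text \<open>\<open>restrict\<close> replaces all coordinates from \<open>k\<close> on by
  \<open>undefined\<close>, a change that \<open>F\<close> cannot see.\<close>

lemma depends_on_prefix_restrict:
  assumes "depends_on_prefix k F"
  shows "F (\<lambda>n. I n \<omega>) = F (\<lambda>n\<in>{..<k}. I n \<omega>)"
  by (rule assms[unfolded depends_on_prefix_def, THEN spec, THEN spec, THEN mp]) simp

lemma random_variable_index: "random_variable (count_space UNIV) (I n)"
  using indep unfolding indep_vars_def by blast

lemma random_variable_prefix:
  "random_variable (PiM {..<k} (\<lambda>_. count_space UNIV)) (\<lambda>\<omega>. \<lambda>n\<in>{..<k}. I n \<omega>)"
  by (rule measurable_restrict) (rule random_variable_index)

text \<open>A finite product of finite discrete spaces is discrete, so every function on it is
  measurable.\<close>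

lemma measurable_prefix_space:
  "F \<in> borel_measurable (PiM {..<k :: nat} (\<lambda>_. count_space (UNIV :: 'b set)))"
  by (subst count_space_PiM_finite) simp_all

lemma borel_measurable_prefix:
  fixes F :: "(nat \<Rightarrow> 'b) \<Rightarrow> real"
  assumes "depends_on_prefix k F"
  shows "(\<lambda>\<omega>. F (\<lambda>n. I n \<omega>)) \<in> borel_measurable M"
  unfolding depends_on_prefix_restrict[OF assms]
  by (rule measurable_compose[OF random_variable_prefix measurable_prefix_space])

lemma integrable_prefix:
  fixes F :: "(nat \<Rightarrow> 'b) \<Rightarrow> real"
  assumes "depends_on_prefix k F"
  shows "integrable M (\<lambda>\<omega>. F (\<lambda>n. I n \<omega>))"
proof -
  have fin: "finite ((\<lambda>s. \<bar>F s\<bar>) ` (PiE {..<k} (\<lambda>_. UNIV)))"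
    by (intro finite_imageI finite_PiE) auto
  have "norm (F (\<lambda>n. I n \<omega>)) \<le> Max ((\<lambda>s. \<bar>F s\<bar>) ` (PiE {..<k} (\<lambda>_. UNIV)))" for \<omega>
    unfolding depends_on_prefix_restrict[OF assms] using fin by (intro Max_ge) auto
  then show ?thesis
    by (intro integrable_const_bound borel_measurable_prefix[OF assms]) auto
qed

text \<open>The index at time \<open>k\<close> is uniform and independent of the prefix that
  determines every \<open>F j\<close>. This replaces a conditional expectation given the past: the
  randomly chosen block is averaged over all blocks.\<close>

lemma expectation_uniform_index:
  fixes F :: "'b \<Rightarrow> (nat \<Rightarrow> 'b) \<Rightarrow> real"
  assumes unif: "distr M (count_space UNIV) (I k) = uniform_count_measure UNIV"
    and prefix: "\<And>j. depends_on_prefix k (F j)"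
  shows "expectation (\<lambda>\<omega>. F (I k \<omega>) (\<lambda>n. I n \<omega>))
    = expectation (\<lambda>\<omega>. \<Sum>j\<in>UNIV. F j (\<lambda>n. I n \<omega>)) / CARD('b)"
    and "integrable M (\<lambda>\<omega>. F (I k \<omega>) (\<lambda>n. I n \<omega>))"
proof -
  note rv = random_variable_index[of k]
  define ind :: "'b \<Rightarrow> 'a \<Rightarrow> real" where "ind j \<omega> = indicator {j} (I k \<omega>)" for j \<omega>
  \<comment> \<open>Splitting by the value of the current index separates it from the past: every
    summand is an indicator of that index times a function of the prefix.\<close>
  have split: "F (I k \<omega>) s = (\<Sum>j\<in>UNIV. ind j \<omega> * F j s)" for \<omega> s
  proof -
    have "ind j \<omega> * F j s = (if j = I k \<omega> then F j s else 0)" for j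
      by (simp add: ind_def)
    then show ?thesis by simp
  qed
  have ind_meas: "ind j \<in> borel_measurable M" for j
    unfolding ind_def[abs_def] using rv by (rule measurable_compose) simp
  have ind_int: "integrable M (ind j)" for j
    by (rule integrable_const_bound[of _ 1]) (auto simp: ind_meas, simp add: ind_def indicator_def)
  have ind_exp: "expectation (ind j) = 1 / CARD('b)" for j
  proof -
    have "expectation (ind j) = (\<integral>x. indicator {j} x \<partial>distr M (count_space UNIV) (I k))"
      unfolding ind_def[abs_def] using rv by (subst integral_distr) auto
    then show ?thesis by (simp add: unif measure_uniform_count_measure)
  qed
  have indep2: "indep_var borel (ind j) borel (\<lambda>\<omega>. F j (\<lambda>n. I n \<omega>))" for j
  proof -
    \<comment> \<open>Subfamilies over the disjoint index sets \<open>{k}\<close> and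
      \<open>{..<k}\<close> are independent.\<close>
    have "indep_var (PiM {k} (\<lambda>_. count_space UNIV)) (\<lambda>\<omega>. \<lambda>n\<in>{k}. I n \<omega>)
        (PiM {..<k} (\<lambda>_. count_space UNIV)) (\<lambda>\<omega>. \<lambda>n\<in>{..<k}. I n \<omega>)"
      by (rule indep_var_restrict[OF indep]) auto
    then have "indep_var borel ((\<lambda>s. indicator {j} (s k)) \<circ> (\<lambda>\<omega>. \<lambda>n\<in>{k}. I n \<omega>))
        borel (F j \<circ> (\<lambda>\<omega>. \<lambda>n\<in>{..<k}. I n \<omega>))"
      by (rule indep_var_compose) (simp_all add: count_space_PiM_finite)
    then show ?thesis
      by (simp add: comp_def ind_def[abs_def] depends_on_prefix_restrict[OF prefix, symmetric])
  qed
  have int: "integrable M (\<lambda>\<omega>. ind j \<omega> * F j (\<lambda>n. I n \<omega>))" for j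
    by (rule indep_var_integrable[OF indep2 ind_int integrable_prefix[OF prefix]])
  then show "integrable M (\<lambda>\<omega>. F (I k \<omega>) (\<lambda>n. I n \<omega>))"
    unfolding split by (rule Bochner_Integration.integrable_sum)
  have "expectation (\<lambda>\<omega>. F (I k \<omega>) (\<lambda>n. I n \<omega>))
      = (\<Sum>j\<in>UNIV. expectation (\<lambda>\<omega>. ind j \<omega> * F j (\<lambda>n. I n \<omega>)))"
    unfolding split using int by (rule Bochner_Integration.integral_sum)
  also have "\<dots> = (\<Sum>j\<in>UNIV. expectation (\<lambda>\<omega>. F j (\<lambda>n. I n \<omega>)) / CARD('b))"
    by (simp add: indep_var_lebesgue_integral[OF indep2 ind_int integrable_prefix[OF prefix]] ind_exp)
  also have "\<dots> = expectation (\<lambda>\<omega>. \<Sum>j\<in>UNIV. F j (\<lambda>n. I n \<omega>)) / CARD('b)"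
    by (subst Bochner_Integration.integral_sum) (simp_all add: integrable_prefix[OF prefix] sum_divide_distrib)
  finally show "expectation (\<lambda>\<omega>. F (I k \<omega>) (\<lambda>n. I n \<omega>))
    = expectation (\<lambda>\<omega>. \<Sum>j\<in>UNIV. F j (\<lambda>n. I n \<omega>)) / CARD('b)" .
qed

end

lemma square_expectation_le:
  fixes X :: "'a \<Rightarrow> real"
  assumes "integrable M X" "integrable M (\<lambda>\<omega>. (X \<omega>)\<^sup>2)"
  shows "(expectation X)\<^sup>2 \<le> expectation (\<lambda>\<omega>. (X \<omega>)\<^sup>2)"
  using variance_eq[OF assms] variance_positive[of X] by simp

text \<open>Every path decreases to its infimum \<open>g\<close>. The expectation of
  \<open>g\<close> lies below that of each \<open>X k\<close>, so it is zero, and a nonnegative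
  function with zero integral vanishes almost everywhere.\<close>

lemma AE_tendsto_zero_of_decseq:
  fixes X :: "nat \<Rightarrow> 'a \<Rightarrow> real"
  assumes int: "\<And>k. integrable M (X k)"
    and nonneg: "\<And>k \<omega>. 0 \<le> X k \<omega>" and dec: "\<And>k \<omega>. X (Suc k) \<omega> \<le> X k \<omega>"
    and lim: "(\<lambda>k. expectation (X k)) \<longlonglongrightarrow> 0"
  shows "AE \<omega> in M. (\<lambda>k. X k \<omega>) \<longlonglongrightarrow> 0"
proof -
  define g where "g \<omega> = (INF k. X k \<omega>)" for \<omega>
  have decs: "decseq (\<lambda>k. X k \<omega>)" for \<omega> by (rule decseq_SucI) (rule dec)
  have bdd: "bdd_below (range (\<lambda>k. X k \<omega>))" for \<omega>
    using nonneg by (intro bdd_belowI[of _ 0]) auto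
  have conv: "(\<lambda>k. X k \<omega>) \<longlonglongrightarrow> g \<omega>" for \<omega>
    unfolding g_def by (rule LIMSEQ_decseq_INF[OF bdd decs])
  have g_le: "g \<omega> \<le> X k \<omega>" for k \<omega> unfolding g_def by (rule cINF_lower[OF bdd]) simp
  have g_nonneg: "0 \<le> g \<omega>" for \<omega> unfolding g_def by (intro cINF_greatest nonneg) simp
  have meas: "g \<in> borel_measurable M"
    using borel_measurable_integrable[OF int] by (rule borel_measurable_LIMSEQ_real[OF conv])
  have g_int: "integrable M g"
    using g_le[of _ 0] g_nonneg by (intro Bochner_Integration.integrable_bound[OF int[of 0] meas]) (auto simp: nonneg)
  have "expectation g \<le> expectation (X k)" for k by (intro integral_mono g_int int g_le)
  then have "expectation g \<le> 0" using lim by (intro LIMSEQ_le_const) auto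
  moreover have "0 \<le> expectation g" using g_nonneg by simp
  ultimately have "expectation g = 0" by simp
  then have "AE \<omega> in M. g \<omega> = 0"
    using integral_nonneg_eq_0_iff_AE[OF g_int] g_nonneg by simp
  then show ?thesis
  proof (rule eventually_mono)
    fix \<omega> assume "g \<omega> = 0"
    then show "(\<lambda>k. X k \<omega>) \<longlonglongrightarrow> 0" using conv[of \<omega>] by simp
  qed
qed

section \<open>Decay of the expected energy, first for source starts and then by density\<close>

lemma expected_energy_tendsto_zero_of_source:
  fixes K :: "'x :: {real_inner, complete_space} \<Rightarrow>\<^sub>L 'y :: real_inner"
    and V :: "real ^ 'b ^ 'd" and I :: "nat \<Rightarrow> 'a \<Rightarrow> 'b" and u :: "'x ^ 'b"
  assumes indep: "indep_vars (\<lambda>_. count_space UNIV) I UNIV"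
    and unif: "\<And>k. distr M (count_space UNIV) (I k) = uniform_count_measure UNIV"
    and rank: "rank V = CARD('b)" and gain: "0 < \<gamma>" "0 < step_gain V K \<gamma>"
  shows "(\<lambda>k. expectation (\<lambda>\<omega>. energy V (block_path V (gram_op K) \<gamma>
    (blockwise (gram_op K) u) (\<lambda>n. I n \<omega>) k))) \<longlonglongrightarrow> 0"
proof -
  define e where "e = blockwise (gram_op K) u"
  define c where "c = step_gain V K \<gamma>"
  define P where "P k s = block_path V (gram_op K) \<gamma> e s k" for k s
  define a where "a k = expectation (\<lambda>\<omega>. energy V (P k (\<lambda>n. I n \<omega>)))" for k
  define F where "F k j s = (norm (K (normal_block V (P k s) $ j)))\<^sup>2" for k j s
  define R where "R k = expectation (\<lambda>\<omega>. \<Sum>j\<in>UNIV. F k j (\<lambda>n. I n \<omega>))" for k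
  have prefix: "depends_on_prefix k (\<lambda>s. G (P k s))" for k and G :: "'x ^ 'b \<Rightarrow> real"
    unfolding P_def by (rule depends_on_prefix_block_path)
  have F_prefix: "depends_on_prefix k (F k j)" for k j
    unfolding F_def by (rule prefix)
  note int = integrable_prefix[OF indep prefix]
  have F_exp: "expectation (\<lambda>\<omega>. F k (I k \<omega>) (\<lambda>n. I n \<omega>)) = R k / CARD('b)"
    and F_int: "integrable M (\<lambda>\<omega>. F k (I k \<omega>) (\<lambda>n. I n \<omega>))" for k
    unfolding R_def by (rule expectation_uniform_index[OF indep unif F_prefix])+
  \<comment> \<open>Expectation of the telescoped estimate. Replacing the sampled block by the sum
    over all blocks costs the factor \<open>CARD('b)\<close>.\<close>
  have R_sum: "(\<Sum>k<n. R k) \<le> CARD('b) * energy V e / c" for n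
  proof -
    have "c * (\<Sum>k<n. F k (I k \<omega>) (\<lambda>n. I n \<omega>)) \<le> energy V e" for \<omega>
      using energy_path_gain[OF gain(1), of V K e "\<lambda>n. I n \<omega>" n]
        energy_nonneg[of V "block_path V (gram_op K) \<gamma> e (\<lambda>n. I n \<omega>) n"]
      by (simp add: F_def P_def c_def)
    then have "(\<Sum>k<n. F k (I k \<omega>) (\<lambda>n. I n \<omega>)) \<le> energy V e / c" for \<omega>
      using gain(2) by (simp add: c_def pos_le_divide_eq mult.commute)
    then have "expectation (\<lambda>\<omega>. \<Sum>k<n. F k (I k \<omega>) (\<lambda>n. I n \<omega>)) \<le> expectation (\<lambda>_. energy V e / c)"
      by (intro integral_mono Bochner_Integration.integrable_sum F_int integrable_const)
    moreover have "expectation (\<lambda>\<omega>. \<Sum>k<n. F k (I k \<omega>) (\<lambda>n. I n \<omega>))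
        = (\<Sum>k<n. expectation (\<lambda>\<omega>. F k (I k \<omega>) (\<lambda>n. I n \<omega>)))"
      by (intro Bochner_Integration.integral_sum F_int)
    ultimately have "(\<Sum>k<n. R k / CARD('b)) \<le> energy V e / c"
      by (simp add: F_exp prob_space)
    then have "(\<Sum>k<n. R k) / CARD('b) \<le> energy V e / c"
      by (simp add: sum_divide_distrib)
    then show ?thesis by (simp add: pos_divide_le_eq mult.commute)
  qed
  obtain B where B: "\<And>x :: 'x ^ 'b. norm (blockwise K x) \<le> norm x * B" "0 \<le> B"
    using bounded_linear.nonneg_bounded[OF bounded_linear_blockwise[OF blinfun.bounded_linear_right]] by blast
  obtain C where C: "0 \<le> C" "\<And>x :: 'x ^ 'b. (norm x)\<^sup>2 \<le> C * energy V x"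
    using norm_le_energy[OF rank] by blast
  \<comment> \<open>A bound on \<open>(norm (blockwise K v))\<^sup>2\<close> valid for all sources
    \<open>v\<close> along the path. The sources obey the same recursion, so their energy never
    exceeds that of \<open>u\<close>; \<open>C\<close> converts energy to norm and \<open>B\<close>
    bounds \<open>blockwise K\<close>.\<close>
  define D where "D = B\<^sup>2 * (C * energy V u)"
  have D: "0 \<le> D" using B C by (simp add: D_def energy_nonneg)
  have lin: "linear (gram_op K)" by (rule bounded_linear.linear[OF bounded_linear_gram_op])
  have pointwise: "(energy V (P k s))\<^sup>2 \<le> D * (\<Sum>j\<in>UNIV. F k j s)" for k s
  proof -
    define v where "v = block_path V (gram_op K) \<gamma> u s k"
    have Pv: "P k s = blockwise (gram_op K) v"
      unfolding P_def e_def v_def by (rule block_path_blockwise[OF lin])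
    have "(norm (blockwise K v))\<^sup>2 \<le> (norm v * B)\<^sup>2" by (intro power_mono B) simp
    also have "\<dots> = B\<^sup>2 * (norm v)\<^sup>2" by (simp add: power_mult_distrib mult.commute)
    also have "\<dots> \<le> B\<^sup>2 * (C * energy V v)" by (intro mult_left_mono C) simp
    also have "\<dots> \<le> D"
      unfolding D_def v_def by (intro mult_left_mono energy_path_le gain C) simp
    finally have "(norm (blockwise K v))\<^sup>2 * (\<Sum>j\<in>UNIV. F k j s) \<le> D * (\<Sum>j\<in>UNIV. F k j s)"
      by (intro mult_right_mono sum_nonneg) (simp_all add: F_def)
    with energy_source_bound[of V K v] show ?thesis by (simp add: Pv F_def)
  qed
  \<comment> \<open>The pointwise bound controls the squared energy, so nonnegativity of the
    variance is used to pass to the square of the expected energy.\<close>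
  have "(a k)\<^sup>2 \<le> D * R k" for k
  proof -
    have "(a k)\<^sup>2 \<le> expectation (\<lambda>\<omega>. (energy V (P k (\<lambda>n. I n \<omega>)))\<^sup>2)"
      unfolding a_def by (intro square_expectation_le int)
    also have "\<dots> \<le> expectation (\<lambda>\<omega>. D * (\<Sum>j\<in>UNIV. F k j (\<lambda>n. I n \<omega>)))"
      by (intro integral_mono int pointwise) (simp add: integrable_prefix[OF indep F_prefix])
    finally show ?thesis by (simp add: R_def)
  qed
  then have "(\<Sum>k<n. (a k)\<^sup>2) \<le> D * (\<Sum>k<n. R k)" for n
    unfolding sum_distrib_left by (intro sum_mono)
  then have "(\<Sum>k<n. (a k)\<^sup>2) \<le> D * (CARD('b) * energy V e / c)" for n
    using mult_left_mono[OF R_sum D] by (rule order_trans)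
  then have "summable (\<lambda>k. (a k)\<^sup>2)" by (intro summableI_nonneg_bounded) auto
  then have "(\<lambda>k. (a k)\<^sup>2) \<longlonglongrightarrow> 0" by (rule summable_LIMSEQ_zero)
  then have "a \<longlonglongrightarrow> 0" by (simp add: tendsto_null_power)
  then show ?thesis by (simp add: a_def[abs_def] P_def e_def)
qed

text \<open>The recursion is linear in its start and never increases the energy. A start close to
  \<open>e\<close> therefore yields errors close in energy at all times and for all index sequences,
  and density supplies such a start with a source.\<close>

lemma expected_energy_tendsto_zero:
  fixes K :: "'x :: {real_inner, complete_space} \<Rightarrow>\<^sub>L 'y :: real_inner"
    and V :: "real ^ 'b ^ 'd" and I :: "nat \<Rightarrow> 'a \<Rightarrow> 'b" and e :: "'x ^ 'b"
  assumes indep: "indep_vars (\<lambda>_. count_space UNIV) I UNIV"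
    and unif: "\<And>k. distr M (count_space UNIV) (I k) = uniform_count_measure UNIV"
    and rank: "rank V = CARD('b)" and gain: "0 < \<gamma>" "0 < step_gain V K \<gamma>"
    and perp: "\<And>q. system_op V K q = 0 \<Longrightarrow> e \<bullet> q = 0"
  shows "(\<lambda>k. expectation (\<lambda>\<omega>. energy V (block_path V (gram_op K) \<gamma> e (\<lambda>n. I n \<omega>) k))) \<longlonglongrightarrow> 0"
proof (rule LIMSEQ_I)
  fix r :: real assume "0 < r"
  define P where "P x k s = block_path V (gram_op K) \<gamma> x s k" for x :: "'x ^ 'b" and k s
  define E where "E x k = expectation (\<lambda>\<omega>. energy V (P x k (\<lambda>n. I n \<omega>)))" for x k
  have lin: "linear (gram_op K)" by (rule bounded_linear.linear[OF bounded_linear_gram_op])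
  have prefix: "depends_on_prefix k (\<lambda>s. G (P x k s))" for k x and G :: "'x ^ 'b \<Rightarrow> real"
    unfolding P_def by (rule depends_on_prefix_block_path)
  note int = integrable_prefix[OF indep prefix]
  have "e \<in> closure (range (blockwise (gram_op K)))"
    using perp by (rule closure_range_blockwise_gram_op)
  then obtain s where s: "\<And>n. s n \<in> range (blockwise (gram_op K))" and lim: "s \<longlonglongrightarrow> e"
    unfolding closure_sequential by blast
  have "(\<lambda>n. energy V (e - s n)) \<longlonglongrightarrow> energy V (e - e)"
    unfolding energy_def
    by (intro tendsto_intros bounded_linear.tendsto[OF bounded_linear_lift_mat] lim)
  then have "(\<lambda>n. energy V (e - s n)) \<longlonglongrightarrow> 0"
    by (simp add: energy_def linear_0[OF linear_lift_mat])
  \<comment> \<open>The threshold \<open>r / 4\<close> anticipates \<open>energy_diff_le\<close>,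
    which doubles both this term and the expected energy of the approximating path.\<close>
  then have "\<forall>\<^sub>F n in sequentially. energy V (e - s n) < r / 4"
    using \<open>0 < r\<close> by (intro order_tendstoD) auto
  then obtain n where n: "energy V (e - s n) < r / 4"
    by (auto simp: eventually_sequentially)
  obtain u where u: "s n = blockwise (gram_op K) u" using s[of n] by blast
  have "(\<lambda>k. E (s n) k) \<longlonglongrightarrow> 0"
    unfolding E_def P_def u
    by (rule expected_energy_tendsto_zero_of_source[OF indep unif rank gain])
  then have "\<forall>\<^sub>F k in sequentially. E (s n) k < r / 4"
    using \<open>0 < r\<close> by (intro order_tendstoD) auto
  then obtain N where N: "\<And>k. k \<ge> N \<Longrightarrow> E (s n) k < r / 4"
    by (auto simp: eventually_sequentially)
  have "norm (E e k - 0) < r" if "k \<ge> N" for k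
  proof -
    have "energy V (P e k t) \<le> 2 * energy V (P (s n) k t) + r / 2" for t
    proof -
      have "P e k t - P (s n) k t = P (e - s n) k t"
        by (simp add: P_def block_path_diff[OF lin])
      then have "energy V (P e k t - P (s n) k t) < r / 4"
        using energy_path_le[OF gain, of "e - s n" t k] n by (simp add: P_def)
      then show ?thesis using energy_diff_le[of V "P e k t" "P (s n) k t"] by simp
    qed
    then have "E e k \<le> expectation (\<lambda>\<omega>. 2 * energy V (P (s n) k (\<lambda>n. I n \<omega>)) + r / 2)"
      unfolding E_def
      by (intro integral_mono int Bochner_Integration.integrable_add integrable_const
          Bochner_Integration.integrable_mult_right)
    also have "\<dots> = 2 * E (s n) k + r / 2"
      by (simp add: E_def int prob_space)
    also have "\<dots> < r" using N[OF that] by simp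
    finally have "E e k < r" .
    moreover have "0 \<le> E e k" by (simp add: E_def energy_nonneg)
    ultimately show ?thesis by simp
  qed
  then show "\<exists>N. \<forall>k\<ge>N. norm (expectation (\<lambda>\<omega>. energy V (block_path V (gram_op K) \<gamma> e (\<lambda>n. I n \<omega>) k)) - 0) < r"
    unfolding E_def P_def by blast
qed

end

theorem theorem2p9:
  fixes V :: "real ^ 'b ^ 'd"
    and K :: "'x :: {real_inner, complete_space} \<Rightarrow>\<^sub>L 'y :: {real_inner, complete_space}"
    and y :: "'y ^ 'd"
    and x0 :: "'x ^ 'b"
    and \<gamma> :: real
    and M :: "'w measure"
    and I :: "nat \<Rightarrow> 'w \<Rightarrow> 'b"
  assumes "y \<in> range (system_op V K)"
    and "rank V = CARD('b)"
    and "prob_space M"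
    and "prob_space.indep_vars M (\<lambda>_. count_space UNIV) I UNIV"
    and "\<And>k. distr M (count_space UNIV) (I k) = uniform_count_measure UNIV"
    and "0 < \<gamma>"
    and "K \<noteq> 0 \<Longrightarrow> \<gamma> < 2 / (vstar V * (norm K)\<^sup>2)"
  shows "(\<exists>!xd. min_norm_solution V K y x0 xd) \<and>
    (\<forall>xd. min_norm_solution V K y x0 xd \<longrightarrow>
      (AE \<omega> in M. (\<lambda>k. norm (rbcd V K y \<gamma> x0 (\<lambda>n. I n \<omega>) k - xd)) \<longlonglongrightarrow> 0) \<and>
      (\<forall>k. integrable M (\<lambda>\<omega>. (norm (rbcd V K y \<gamma> x0 (\<lambda>n. I n \<omega>) k - xd))\<^sup>2)) \<and>
      (\<lambda>k. prob_space.expectation M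
             (\<lambda>\<omega>. (norm (rbcd V K y \<gamma> x0 (\<lambda>n. I n \<omega>) k - xd))\<^sup>2)) \<longlonglongrightarrow> 0)"
proof -
  interpret prob_space M by fact
  have gain: "0 < step_gain V K \<gamma>" by (rule step_gain_pos) fact+
  obtain xd where sol: "system_op V K xd = y"
    and perp: "\<And>q. system_op V K q = 0 \<Longrightarrow> (x0 - xd) \<bullet> q = 0"
    and unique: "\<And>x. min_norm_solution V K y x0 x \<longleftrightarrow> x = xd"
    using min_norm_solution_exists_unique[OF assms(1), of x0] by metis
  define P where "P k s = block_path V (gram_op K) \<gamma> (x0 - xd) s k" for k s
  define X where "X k \<omega> = energy V (P k (\<lambda>n. I n \<omega>))" for k \<omega>
  have error: "rbcd V K y \<gamma> x0 s k - xd = P k s" for s k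
    unfolding P_def by (rule rbcd_error[OF sol])
  have prefix: "depends_on_prefix k (\<lambda>s. G (P k s))" for k and G :: "'x ^ 'b \<Rightarrow> real"
    unfolding P_def by (rule depends_on_prefix_block_path)
  note int = integrable_prefix[OF assms(4) prefix]
  obtain C where C: "0 \<le> C" "\<And>x :: 'x ^ 'b. (norm x)\<^sup>2 \<le> C * energy V x"
    using norm_le_energy[OF assms(2)] by blast
  have lim: "(\<lambda>k. expectation (X k)) \<longlonglongrightarrow> 0"
    unfolding X_def[abs_def] P_def
    by (rule expected_energy_tendsto_zero[OF assms(4,5,2,6) gain perp])
  \<comment> \<open>Almost sure convergence is obtained for the energy, which is monotone along
    every path, and only then carried over to the norm.\<close>
  have AE: "AE \<omega> in M. (\<lambda>k. X k \<omega>) \<longlonglongrightarrow> 0"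
  proof (rule AE_tendsto_zero_of_decseq[OF _ _ _ lim])
    show "integrable M (X k)" for k unfolding X_def[abs_def] by (rule int)
    show "0 \<le> X k \<omega>" for k \<omega> by (simp add: X_def energy_nonneg)
    show "X (Suc k) \<omega> \<le> X k \<omega>" for k \<omega>
      unfolding X_def P_def by (rule energy_path_Suc_le[OF assms(6) gain])
  qed
  have "(\<lambda>k. norm (P k (\<lambda>n. I n \<omega>))) \<longlonglongrightarrow> 0" if "(\<lambda>k. X k \<omega>) \<longlonglongrightarrow> 0" for \<omega>
  proof -
    have "(\<lambda>k. C * X k \<omega>) \<longlonglongrightarrow> 0" using tendsto_mult_right_zero[OF that] .
    then have "(\<lambda>k. (norm (P k (\<lambda>n. I n \<omega>)))\<^sup>2) \<longlonglongrightarrow> 0"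
      by (rule tendsto_sandwich[OF _ _ tendsto_const, rotated -1]) (simp_all add: C X_def)
    then show ?thesis by simp
  qed
  with AE have "AE \<omega> in M. (\<lambda>k. norm (P k (\<lambda>n. I n \<omega>))) \<longlonglongrightarrow> 0"
    by (rule eventually_mono)
  moreover have norm_int: "integrable M (\<lambda>\<omega>. (norm (P k (\<lambda>n. I n \<omega>)))\<^sup>2)" for k
    by (rule int)
  \<comment> \<open>The norm equivalence constant \<open>C\<close> is deterministic, so the same
    sandwich works under the expectation.\<close>
  moreover have "(\<lambda>k. expectation (\<lambda>\<omega>. (norm (P k (\<lambda>n. I n \<omega>)))\<^sup>2)) \<longlonglongrightarrow> 0"
  proof (rule tendsto_sandwich[OF _ _ tendsto_const])
    show "(\<lambda>k. C * expectation (X k)) \<longlonglongrightarrow> 0" using tendsto_mult_right_zero[OF lim] .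
    have "expectation (\<lambda>\<omega>. (norm (P k (\<lambda>n. I n \<omega>)))\<^sup>2) \<le> expectation (\<lambda>\<omega>. C * X k \<omega>)" for k
      unfolding X_def by (intro integral_mono norm_int C Bochner_Integration.integrable_mult_right int)
    then show "\<forall>\<^sub>F k in sequentially. expectation (\<lambda>\<omega>. (norm (P k (\<lambda>n. I n \<omega>)))\<^sup>2) \<le> C * expectation (X k)"
      by simp
  qed simp
  ultimately show ?thesis by (simp add: unique error)
qed

end
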